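(* Let $\psi(a,c,x)$ denote the Tricomi confluent hypergeometric function of the second kind. (i) If $a>0>c$ and $x>0$, then $$\left(\frac{\Gamma(a-c+1)}{\Gamma(-c)}\psi(a+1,c+1,x)\right)^{\frac{1}{a+1}}<\left(\frac{\Gamma(a-c+1)}{\Gamma(1-c)}\psi(a,c,x)\right)^{\frac{1}{a}}$$ and $$2<\frac{\psi(a,c,x)}{\psi(a+1,c+1,x)}-\frac{1}{c}\left(\frac{\Gamma(a-c+1)}{\Gamma(1-c)}\psi(a,c,x)\right)^{\frac{1}{a}}.$$ (ii) If $a>0$, $c<-1$ and $x>0$, then $$\left(\frac{\Gamma(a-c+1)}{\Gamma(1-c)}\psi(a,c,x)\right)^{\frac{c}{a(c+1)}}<\left(\frac{\Gamma(a-c+1)}{\Gamma(-c)}\psi(a+1,c+1,x)\right)^{\frac{1}{a+1}}.$$ (iii) If $a>0>c$ and $x>0$, then $$\psi(a+1,c+1,x)<-\frac{1}{c}\psi(a,c,x).$$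
   Context: For $a>0$, $c\in\mathbb{R}$ and $x>0$, $\psi(a,c,x)$ is the Tricomi confluent hypergeometric function of the second kind (often written $U(a,c,x)$), a particular solution of Kummer's differential equation $xy''(x)+(c-x)y'(x)-ay(x)=0$, given by $$\psi(a,c,x)=\frac{1}{\Gamma(a)}\int_{0}^{\infty}e^{-xt}t^{a-1}(1+t)^{c-a-1}\,dt.$$ $\Gamma$ denotes Euler's gamma function. *)

theory Defs
  imports "HOL-Analysis.Analysis"
begin

text \<open>
  The integrand is taken on the open half-line; for \<open>a > 0\<close> and \<open>x > 0\<close> it is positive and
  integrable there. Outside this parameter range the value carries no meaning.
\<close>

definition tricomi :: "real \<Rightarrow> real \<Rightarrow> real \<Rightarrow> real" where
  "tricomi a c x =
     1 / Gamma a *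
     (LBINT t:{0<..}. exp (- (x * t)) * t powr (a - 1) * (1 + t) powr (c - a - 1))"

end

(*
  Put m = a - c + 1 and let P s be the Laplace transform at x of the beta prime distribution with
  parameters s and m - s. Then the two normalised Tricomi functions are F = P a and G = P (a + 1).

  The kernel h t = exp(-xt) (1 + t)^(-m) is compared with g t = A (B + t)^(-m), all of whose
  moments are explicit. For B <= 1 the function ln (h / g) is concave, so h - g changes sign at
  most twice, and at most once on t > 0 if h and g agree at 0. Matching the moment of order a and
  h 0 = g 0 gives G < F^((a + 1) / a), whence (iii) and, with AM-GM, both parts of (i). Matching
  the moments of orders a and a + 1 gives the Turan inequality P (a + 2) P a < (P (a + 1))^2.
  Since d/dx P s is a negative multiple of P (s + 1), that inequality says exactly that
  ln G - k ln F, which vanishes at x = 0, has positive derivative for the exponent k of (ii).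
*)
theory Submission
  imports Defs
begin


section \<open>Integrals over the open half-line and the beta prime integral\<close>

text \<open>If the integral were zero, the function would vanish almost everywhere, contradicting
  strict negativity on an interval of length 1 beyond \<open>T\<close>. Strictness is asked only
  beyond \<open>T\<close> because the integrands used later vanish at the points where a sign change
  is cancelled.\<close>

lemma set_integral_neg:
  fixes f :: "real \<Rightarrow> real"
  assumes int: "set_integrable lborel {0<..} f"
    and nonpos: "\<And>t. t > 0 \<Longrightarrow> f t \<le> 0"
    and neg: "\<And>t. t > T \<Longrightarrow> f t < 0"
  shows "(LBINT t:{0<..}. f t) < 0"
proof -
  define g where "g = (\<lambda>t. - (indicator {0<..} t *\<^sub>R f t))"
  have g: "integrable lborel g"
    using int by (simp add: g_def set_integrable_def)
  have g_nonneg: "g t \<ge> 0" for t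
    using nonpos[of t] by (auto simp: g_def indicator_def)
  have "integral\<^sup>L lborel g \<noteq> 0"
  proof
    assume "integral\<^sup>L lborel g = 0"
    then have "AE t in lborel. g t = 0"
      using integral_nonneg_eq_0_iff_AE[OF g] g_nonneg by simp
    then have "AE t in lborel. t \<notin> {max 0 T<..max 0 T + 1}"
      by eventually_elim (use neg in \<open>fastforce simp: g_def\<close>)
    then have "{max 0 T<..max 0 T + 1} \<in> null_sets lborel"
      by (subst AE_iff_null_sets) auto
    then show False
      by auto
  qed
  moreover have "integral\<^sup>L lborel g \<ge> 0"
    using g_nonneg by (intro integral_nonneg_AE) auto
  ultimately show ?thesis
    by (simp add: g_def set_lebesgue_integral_def)
qed

text \<open>The substitution \<open>t = B * u / (1 - u)\<close> maps the unit interval onto the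
  half-line and turns the integrand into a multiple of Euler's beta integrand.\<close>

lemma beta_prime_integral:
  fixes B s m :: real
  assumes "B > 0" "0 < s" "s < m"
  shows "set_integrable lborel {0<..} (\<lambda>t. t powr (s - 1) * (B + t) powr (- m))"
    and "(LBINT t:{0<..}. t powr (s - 1) * (B + t) powr (- m)) = B powr (s - m) * Beta s (m - s)"
proof -
  let ?f = "\<lambda>t::real. t powr (s - 1) * (B + t) powr (- m)"
  let ?g = "\<lambda>u::real. B * u / (1 - u)"
  let ?g' = "\<lambda>u::real. B / (1 - u)\<^sup>2"
  let ?h = "\<lambda>u::real. u powr (s - 1) * (1 - u) powr (m - s - 1)"
  have hint: "(?h has_integral Beta s (m - s)) {0<..<1}"
    using has_integral_Beta_real[of s "m - s"] assms by (simp add: has_integral_Icc_iff_Ioo)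
  have eq: "\<bar>?g' u\<bar> * ?f (?g u) = B powr (s - m) * ?h u" if u: "u \<in> {0<..<1}" for u
  proof -
    have pos: "0 < ?g u" "0 < B / (1 - u)" "\<bar>?g' u\<bar> = B / (1 - u)\<^sup>2"
      using u \<open>B > 0\<close> by simp_all
    have sum: "B + ?g u = B / (1 - u)"
      using u by (simp add: field_simps)
    have "\<bar>?g' u\<bar> = exp (ln B - 2 * ln (1 - u))"
      using u \<open>B > 0\<close> by (simp add: exp_diff exp_double)
    moreover have "?g u powr (s - 1) = exp ((s - 1) * (ln B + ln u - ln (1 - u)))"
      using u \<open>B > 0\<close> pos(1) by (simp add: powr_def ln_mult ln_div)
    moreover have "(B + ?g u) powr (- m) = exp (- m * (ln B - ln (1 - u)))"
      using u \<open>B > 0\<close> pos(2) unfolding sum by (simp add: powr_def ln_div)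
    ultimately have "\<bar>?g' u\<bar> * ?f (?g u) = exp (ln B - 2 * ln (1 - u)
        + (s - 1) * (ln B + ln u - ln (1 - u)) + - m * (ln B - ln (1 - u)))"
      by (simp only: exp_add mult.assoc)
    also have "ln B - 2 * ln (1 - u) + (s - 1) * (ln B + ln u - ln (1 - u)) + - m * (ln B - ln (1 - u))
        = (s - m) * ln B + ((s - 1) * ln u + (m - s - 1) * ln (1 - u))"
      by (simp add: algebra_simps)
    also have "exp \<dots> = B powr (s - m) * ?h u"
      using u \<open>B > 0\<close> by (simp add: powr_def exp_add)
    finally show ?thesis .
  qed
  have "((\<lambda>u. B powr (s - m) * ?h u) has_integral B powr (s - m) * Beta s (m - s)) {0<..<1}"
    using hint by (rule has_integral_mult_right)
  then have "((\<lambda>u. \<bar>?g' u\<bar> * ?f (?g u)) has_integral B powr (s - m) * Beta s (m - s)) {0<..<1}"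
    by (rule has_integral_eq[rotated]) (use eq in simp)
  moreover then have "(\<lambda>u. \<bar>?g' u\<bar> * ?f (?g u)) absolutely_integrable_on {0<..<1}"
    by (intro nonnegative_absolutely_integrable_1) (auto simp: has_integral_integrable)
  ultimately have lhs: "(\<lambda>u. \<bar>?g' u\<bar> * ?f (?g u)) absolutely_integrable_on {0<..<1} \<and>
      integral {0<..<1} (\<lambda>u. \<bar>?g' u\<bar> * ?f (?g u)) = B powr (s - m) * Beta s (m - s)"
    by (simp add: integral_unique)
  have deriv: "(?g has_field_derivative ?g' u) (at u within {0<..<1})" if "u \<in> {0<..<1}" for u
    using that by (auto intro!: derivative_eq_intros simp: power2_eq_square field_simps)
  have inj: "inj_on ?g {0<..<1}"
    using \<open>B > 0\<close> by (auto simp: inj_on_def field_simps)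
  have "t \<in> ?g ` {0<..<1}" if "t > 0" for t
  proof (rule image_eqI)
    have "1 - t / (B + t) = B / (B + t)"
      using that \<open>B > 0\<close> by (simp add: field_simps)
    then show "t = ?g (t / (B + t))"
      using that \<open>B > 0\<close> by simp
  qed (use that \<open>B > 0\<close> in auto)
  then have img: "?g ` {0<..<1} = {0<..}"
    using \<open>B > 0\<close> by auto
  have "?f absolutely_integrable_on {0<..} \<and> integral {0<..} ?f = B powr (s - m) * Beta s (m - s)"
    \<comment> \<open>The change of variables transfers absolute integrability together with the
      value.\<close>
    using lhs has_absolute_integral_change_of_variables_1'[OF _ deriv inj, of ?f "B powr (s - m) * Beta s (m - s)"]
    by (simp add: img)
  then have leb: "?f absolutely_integrable_on {0<..}"
    and val: "integral {0<..} ?f = B powr (s - m) * Beta s (m - s)"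
    by auto
  \<comment> \<open>Absolute integrability refers to the completed measure; Borel measurability of
    the integrand brings it back to \<open>lborel\<close>.\<close>
  show int: "set_integrable lborel {0<..} ?f"
    using leb unfolding set_integrable_def by (subst (asm) integrable_completion) auto
  show "(LBINT t:{0<..}. ?f t) = B powr (s - m) * Beta s (m - s)"
    using set_borel_integral_eq_integral(2)[OF int] val by simp
qed

section \<open>Laplace transforms of beta prime distributions\<close>

definition beta_laplace :: "real \<Rightarrow> real \<Rightarrow> real \<Rightarrow> real" where
  "beta_laplace m s y = (LBINT t:{0<..}. exp (- (y * t)) * t powr (s - 1) * (1 + t) powr (- m))"

text \<open>
  For \<open>0 < s < m\<close> this is the Laplace transform of the beta prime distribution with
  parameters \<open>s\<close> and \<open>m - s\<close>. Keeping \<open>m\<close> fixed, \<open>s \<mapsto> s + 1\<close> corresponds to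
  \<open>\<psi>(a, c, x) \<mapsto> \<psi>(a + 1, c + 1, x)\<close>, with \<open>m = a - c + 1\<close>.
\<close>
definition beta_laplace_norm :: "real \<Rightarrow> real \<Rightarrow> real \<Rightarrow> real" where
  "beta_laplace_norm m s y = beta_laplace m s y / Beta s (m - s)"

lemma beta_laplace_integrable:
  fixes m s y :: real
  assumes "0 < s" "s < m" "y \<ge> 0"
  shows "set_integrable lborel {0<..} (\<lambda>t. exp (- (y * t)) * t powr (s - 1) * (1 + t) powr (- m))"
proof (rule set_integrable_bound[OF beta_prime_integral(1)[of 1 s m]])
  show "AE t in lborel. t \<in> {0<..} \<longrightarrow>
      norm (exp (- (y * t)) * t powr (s - 1) * (1 + t) powr (- m))
        \<le> norm (t powr (s - 1) * (1 + t) powr (- m))"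
    using assms by (auto simp: abs_mult mult.assoc intro!: mult_left_le_one_le)
qed (use assms in \<open>auto simp: set_borel_measurable_def\<close>)

lemma Beta_pos:
  fixes p q :: real
  assumes "p > 0" "q > 0"
  shows "Beta p q > 0"
  using assms by (simp add: Beta_def)

lemma beta_laplace_0:
  assumes "0 < s" "s < m"
  shows "beta_laplace m s 0 = Beta s (m - s)"
  using beta_prime_integral(2)[of 1 s m] assms by (simp add: beta_laplace_def)

lemma beta_laplace_pos:
  assumes "0 < s" "s < m" "y \<ge> 0"
  shows "beta_laplace m s y > 0"
proof -
  have "(LBINT t:{0<..}. - (exp (- (y * t)) * t powr (s - 1) * (1 + t) powr (- m))) < 0"
    by (rule set_integral_neg[where T = 0])
       (use beta_laplace_integrable[OF assms] in \<open>auto simp: set_integrable_def\<close>)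
  then show ?thesis
    by (simp add: beta_laplace_def set_lebesgue_integral_def)
qed

lemma beta_laplace_less_Beta:
  assumes "0 < s" "s < m" "y > 0"
  shows "beta_laplace m s y < Beta s (m - s)"
proof -
  let ?h = "\<lambda>y t. exp (- (y * t)) * t powr (s - 1) * (1 + t) powr (- m)"
  have "(LBINT t:{0<..}. ?h y t - ?h 0 t) < 0"
  proof (rule set_integral_neg[where T = 0])
    show "set_integrable lborel {0<..} (\<lambda>t. ?h y t - ?h 0 t)"
      using assms by (intro set_integral_diff beta_laplace_integrable) auto
    show "?h y t - ?h 0 t < 0" if "t > 0" for t
      using that assms by simp
    then show "?h y t - ?h 0 t \<le> 0" if "t > 0" for t
      using that by force
  qed
  then have "beta_laplace m s y < beta_laplace m s 0"
    using beta_laplace_integrable[of s m y] beta_laplace_integrable[of s m 0] assms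
    by (simp add: beta_laplace_def set_integral_diff)
  then show ?thesis
    using assms by (simp add: beta_laplace_0)
qed

lemma beta_laplace_norm_pos:
  assumes "0 < s" "s < m" "y \<ge> 0"
  shows "beta_laplace_norm m s y > 0"
  using assms beta_laplace_pos[of s m y] Beta_pos[of s "m - s"] by (simp add: beta_laplace_norm_def)

lemma beta_laplace_norm_less_1:
  assumes "0 < s" "s < m" "y > 0"
  shows "beta_laplace_norm m s y < 1"
  using assms beta_laplace_less_Beta[of s m y] Beta_pos[of s "m - s"] by (simp add: beta_laplace_norm_def)

lemma beta_laplace_norm_0:
  assumes "0 < s" "s < m"
  shows "beta_laplace_norm m s 0 = 1"
  using assms beta_laplace_0[of s m] Beta_pos[of s "m - s"] by (simp add: beta_laplace_norm_def)


section \<open>Sign changes of concave functions\<close>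

lemma concave_on_nonneg_between:
  fixes f :: "real \<Rightarrow> real"
  assumes "concave_on S f" "u \<in> S" "v \<in> S" "f u \<ge> 0" "f v \<ge> 0" "u \<le> t" "t \<le> v"
  shows "f t \<ge> 0"
proof (cases "u = v")
  case False
  let ?c = "(t - u) / (v - u)"
  have c: "0 \<le> ?c" "?c \<le> 1"
    using False assms by (auto simp: divide_simps)
  have "(1 - ?c) * u + ?c * v = u + ?c * (v - u)"
    by (simp only: algebra_simps)
  also have "\<dots> = t"
    using False by simp
  finally have "f t \<ge> (1 - ?c) * f u + ?c * f v"
    using concave_onD[OF assms(1) c assms(2,3)] by simp
  moreover have "(1 - ?c) * f u + ?c * f v \<ge> 0"
    using c assms by (intro add_nonneg_nonneg mult_nonneg_nonneg) auto
  ultimately show ?thesis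
    by linarith
qed (use assms in auto)

text \<open>Take \<open>r\<close> to be the supremum of the points where \<open>f\<close> is
  positive: concavity and \<open>f 0 = 0\<close> keep \<open>f\<close> nonnegative before it. The
  product form is what gets multiplied into an integrand later.\<close>

lemma concave_on_one_sign_change:
  fixes f :: "real \<Rightarrow> real"
  assumes conc: "concave_on {0..} f" and "f 0 = 0" and neg: "\<And>t. t > T \<Longrightarrow> f t < 0"
  obtains r where "\<And>t. t > 0 \<Longrightarrow> (t - r) * f t \<le> 0"
proof -
  define S where "S = {t. t > 0 \<and> f t > 0}"
  have bdd: "bdd_above S"
    using neg by (intro bdd_aboveI[of _ T]) (force simp: S_def not_le[symmetric])
  show thesis
  proof (cases "S = {}")
    case True
    have "f t \<le> 0" if "t > 0" for t
      by (rule ccontr) (use True that in \<open>auto simp: S_def not_le\<close>)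
    then show ?thesis
      by (intro that[of 0]) (auto simp: mult_le_0_iff)
  next
    case False
    show ?thesis
    proof (rule that[of "Sup S"])
      fix t :: real assume "t > 0"
      show "(t - Sup S) * f t \<le> 0"
      proof (cases "t < Sup S")
        case True
        then obtain u where "u \<in> S" "t < u"
          using less_cSup_iff[OF False bdd] by auto
        have "f t \<ge> 0"
          by (rule concave_on_nonneg_between[OF conc, of 0 u])
            (use \<open>u \<in> S\<close> \<open>t < u\<close> \<open>t > 0\<close> \<open>f 0 = 0\<close> in \<open>auto simp: S_def\<close>)
        then show ?thesis
          using True by (simp add: mult_le_0_iff)
      next
        case ge: False
        show ?thesis
        proof (cases "t \<in> S")
          case True
          then have "t = Sup S"
            using ge cSup_upper[OF _ bdd] by force
          then show ?thesis by simp
        qed (use ge \<open>t > 0\<close> in \<open>auto simp: S_def mult_le_0_iff not_less\<close>)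
      qed
    qed
  qed
qed

text \<open>Without a zero at 0, the positivity set may also begin late, so its infimum serves as a
  second root; between the two, concavity gives nonnegativity.\<close>

lemma concave_on_two_sign_changes:
  fixes f :: "real \<Rightarrow> real"
  assumes conc: "concave_on {0..} f" and neg: "\<And>t. t > T \<Longrightarrow> f t < 0"
  obtains r1 r2 where "\<And>t. t > 0 \<Longrightarrow> (t - r1) * (t - r2) * f t \<le> 0"
proof -
  define S where "S = {t. t > 0 \<and> f t > 0}"
  have bdd: "bdd_above S"
    using neg by (intro bdd_aboveI[of _ T]) (force simp: S_def not_le[symmetric])
  have bdd': "bdd_below S"
    by (intro bdd_belowI[of _ 0]) (auto simp: S_def)
  show thesis
  proof (cases "S = {}")
    case True
    have "f t \<le> 0" if "t > 0" for t
      by (rule ccontr) (use True that in \<open>auto simp: S_def not_le\<close>)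
    then show ?thesis
      by (intro that[of 0 0]) (auto simp: mult_le_0_iff)
  next
    case False
    show ?thesis
    proof (rule that[of "Inf S" "Sup S"])
      fix t :: real assume "t > 0"
      have out: "f t \<le> 0" if "t \<notin> S"
        using that \<open>t > 0\<close> by (auto simp: S_def)
      consider "t < Inf S" | "t > Sup S" | "t = Inf S" | "t = Sup S" | "Inf S < t" "t < Sup S"
        by linarith
      then show "(t - Inf S) * (t - Sup S) * f t \<le> 0"
      proof cases
        case 1
        then have "t \<notin> S"
          using cInf_lower[OF _ bdd'] by force
        moreover have "t < Sup S"
          using 1 cInf_le_cSup[OF False bdd bdd'] by simp
        ultimately show ?thesis
          using 1 out by (intro mult_nonneg_nonpos mult_nonpos_nonpos) auto
      next
        case 2
        then have "t \<notin> S"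
          using cSup_upper[OF _ bdd] by force
        moreover have "t > Inf S"
          using 2 cInf_le_cSup[OF False bdd bdd'] by simp
        ultimately show ?thesis
          using 2 out by (intro mult_nonneg_nonpos mult_nonneg_nonneg) auto
      next
        case 5
        obtain u where "u \<in> S" "u < t"
          using 5 cInf_less_iff[OF False bdd'] by auto
        moreover obtain v where "v \<in> S" "t < v"
          using 5 less_cSup_iff[OF False bdd] by auto
        ultimately have "f t \<ge> 0"
          using concave_on_nonneg_between[OF conc, of u v t] by (simp add: S_def)
        then show ?thesis
          using 5 by (intro mult_nonpos_nonneg mult_nonneg_nonpos) auto
      qed auto
    qed
  qed
qed

section \<open>Comparing the kernel with a shifted power\<close>

text \<open>
  The logarithm of \<open>exp (- (y * t)) * (1 + t) powr (- m)\<close> divided by \<open>A * (B + t) powr (- m)\<close>.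
\<close>
definition log_ratio :: "real \<Rightarrow> real \<Rightarrow> real \<Rightarrow> real \<Rightarrow> real \<Rightarrow> real" where
  "log_ratio m y A B t = m * (ln (B + t) - ln (1 + t)) - y * t - ln A"

definition gap :: "real \<Rightarrow> real \<Rightarrow> real \<Rightarrow> real \<Rightarrow> real \<Rightarrow> real" where
  "gap m y A B t = exp (- (y * t)) * (1 + t) powr (- m) - A * (B + t) powr (- m)"

text \<open>The positive prefactor shows that \<open>gap\<close> has the sign of
  \<open>log_ratio\<close>, so concavity arguments for the latter control the former.\<close>

lemma gap_eq:
  assumes "A > 0" "B > 0" "t \<ge> 0"
  shows "gap m y A B t = A * (B + t) powr (- m) * (exp (log_ratio m y A B t) - 1)"
proof -
  have "A * (B + t) powr (- m) * exp (log_ratio m y A B t)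
      = exp (ln A + - m * ln (B + t) + log_ratio m y A B t)"
    using assms by (simp add: powr_def exp_add exp_diff exp_minus divide_inverse)
  also have "ln A + - m * ln (B + t) + log_ratio m y A B t = - (y * t) + - m * ln (1 + t)"
    by (simp add: log_ratio_def algebra_simps)
  also have "exp \<dots> = exp (- (y * t)) * (1 + t) powr (- m)"
    using assms by (simp add: powr_def exp_add exp_diff exp_minus divide_inverse)
  finally show ?thesis
    by (simp add: gap_def algebra_simps)
qed

lemma mult_gap_nonpos:
  assumes "A > 0" "B > 0" "t \<ge> 0" "c * log_ratio m y A B t \<le> 0"
  shows "c * gap m y A B t \<le> 0"
proof -
  have "c * (exp (log_ratio m y A B t) - 1) \<le> 0"
    using assms(4) by (auto simp: mult_le_0_iff)
  then have "A * (B + t) powr (- m) * (c * (exp (log_ratio m y A B t) - 1)) \<le> 0"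
    using assms by (intro mult_nonneg_nonpos[of "A * (B + t) powr (- m)"]) auto
  then show ?thesis
    using assms by (simp add: gap_eq mult_ac)
qed

lemma gap_neg:
  assumes "A > 0" "B > 0" "t \<ge> 0" "log_ratio m y A B t < 0"
  shows "gap m y A B t < 0"
  using assms by (subst gap_eq) (auto intro!: mult_pos_neg)

text \<open>For \<open>B \<le> 1\<close> the term \<open>1 / (B + t)\<^sup>2\<close> dominates
  \<open>1 / (1 + t)\<^sup>2\<close> in the second derivative; the linear part in \<open>y\<close>
  does not contribute.\<close>

lemma concave_on_log_ratio:
  assumes "0 < B" "B \<le> 1" "m \<ge> 0"
  shows "concave_on {0..} (log_ratio m y A B)"
proof (rule f''_le0_imp_concave)
  fix t :: real assume t: "t \<in> {0..}"
  show "(log_ratio m y A B has_real_derivative m * (1 / (B + t) - 1 / (1 + t)) - y) (at t)"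
    unfolding log_ratio_def using t assms by (auto intro!: derivative_eq_intros)
  show "((\<lambda>t. m * (1 / (B + t) - 1 / (1 + t)) - y) has_real_derivative
      m * (1 / (1 + t)\<^sup>2 - 1 / (B + t)\<^sup>2)) (at t)"
    using t assms by (auto intro!: derivative_eq_intros simp: power2_eq_square)
  have "(B + t)\<^sup>2 \<le> (1 + t)\<^sup>2"
    using t assms by (intro power_mono) auto
  then have "1 / (1 + t)\<^sup>2 \<le> 1 / (B + t)\<^sup>2"
    using t assms by (intro divide_left_mono) auto
  then show "m * (1 / (1 + t)\<^sup>2 - 1 / (B + t)\<^sup>2) \<le> 0"
    using assms by (intro mult_nonneg_nonpos) auto
qed auto

text \<open>Since \<open>B \<le> 1\<close> makes the difference of logarithms nonpositive, it is
  enough that \<open>y * t\<close> exceeds \<open>\<bar>ln A\<bar>\<close>.\<close>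

lemma log_ratio_neg:
  assumes "0 < B" "B \<le> 1" "m \<ge> 0" "y > 0" "t > \<bar>ln A\<bar> / y"
  shows "log_ratio m y A B t < 0"
proof -
  have "t > 0"
    using assms by (smt (verit) divide_nonneg_pos)
  then have "m * (ln (B + t) - ln (1 + t)) \<le> 0"
    using assms by (intro mult_nonneg_nonpos) auto
  moreover have "y * t > \<bar>ln A\<bar>"
    using assms by (simp add: field_simps)
  ultimately show ?thesis
    by (simp add: log_ratio_def)
qed

text \<open>Both kernels contribute the same Beta factor, so a moment of \<open>gap\<close> vanishes
  exactly when \<open>A * B powr (s - m)\<close> equals the normalised transform.\<close>

lemma gap_moment:
  assumes "B > 0" "0 < s" "s < m" "y \<ge> 0"
  shows "set_integrable lborel {0<..} (\<lambda>t. t powr (s - 1) * gap m y A B t)"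
    and "(LBINT t:{0<..}. t powr (s - 1) * gap m y A B t)
      = Beta s (m - s) * (beta_laplace_norm m s y - A * B powr (s - m))"
proof -
  let ?h = "\<lambda>t. exp (- (y * t)) * t powr (s - 1) * (1 + t) powr (- m)"
  let ?g = "\<lambda>t. t powr (s - 1) * (B + t) powr (- m)"
  have eq: "(\<lambda>t. t powr (s - 1) * gap m y A B t) = (\<lambda>t. ?h t - A * ?g t)"
    by (simp add: gap_def fun_eq_iff algebra_simps)
  have h: "set_integrable lborel {0<..} ?h" and g: "set_integrable lborel {0<..} (\<lambda>t. A * ?g t)"
    using beta_laplace_integrable[of s m y] beta_prime_integral(1)[of B s m] assms by auto
  show "set_integrable lborel {0<..} (\<lambda>t. t powr (s - 1) * gap m y A B t)"
    unfolding eq using h g by (rule set_integral_diff)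
  have "(LBINT t:{0<..}. ?h t - A * ?g t) = beta_laplace m s y - A * (B powr (s - m) * Beta s (m - s))"
    using assms by (simp add: set_integral_diff(2)[OF h g] beta_laplace_def beta_prime_integral(2))
  also have "beta_laplace m s y = Beta s (m - s) * beta_laplace_norm m s y"
    using Beta_pos[of s "m - s"] assms by (simp add: beta_laplace_norm_def)
  finally show "(LBINT t:{0<..}. t powr (s - 1) * gap m y A B t)
      = Beta s (m - s) * (beta_laplace_norm m s y - A * B powr (s - m))"
    unfolding eq by (simp add: algebra_simps)
qed

section \<open>Inequalities between neighbouring transforms by moment matching\<close>

text \<open>If \<open>r\<close> is the only possible sign change of \<open>gap\<close> on the
  half-line, then \<open>(t - r) * gap\<close> is nonpositive. Its integral against
  \<open>t powr (s - 1)\<close> is negative, and the term with \<open>r\<close> is zero by the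
  choice of \<open>A\<close> and \<open>B\<close>, so the moment of order \<open>s + 1\<close> is
  negative.\<close>

lemma beta_laplace_norm_less_powr:
  assumes "0 < s" "s + 1 < m" "y > 0"
  shows "beta_laplace_norm m (s + 1) y < beta_laplace_norm m s y powr ((s + 1) / s)"
proof -
  let ?F = "beta_laplace_norm m s y"
  \<comment> \<open>Chosen so that \<open>gap\<close> vanishes at 0 and its moment with weight \<open>t powr (s - 1)\<close> is zero.\<close>
  define B where "B = ?F powr (1 / s)"
  define A where "A = B powr m"
  have F: "0 < ?F" "?F < 1"
    using assms by (auto intro!: beta_laplace_norm_pos beta_laplace_norm_less_1)
  have B: "0 < B" "B \<le> 1"
    using F assms by (auto simp: B_def powr_le1)
  have A: "A > 0" "ln A = m * ln B"
    using B by (auto simp: A_def)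
  have conc: "concave_on {0..} (log_ratio m y A B)"
    using B assms by (intro concave_on_log_ratio) auto
  have zero: "log_ratio m y A B 0 = 0"
    using A by (simp add: log_ratio_def)
  have neg: "log_ratio m y A B t < 0" if "t > \<bar>ln A\<bar> / y" for t
    using that B assms by (intro log_ratio_neg) auto
  obtain r where r: "\<And>t. t > 0 \<Longrightarrow> (t - r) * log_ratio m y A B t \<le> 0"
    by (rule concave_on_one_sign_change[OF conc zero neg]) blast+
  let ?M = "\<lambda>s t. t powr (s - 1) * gap m y A B t"
  have int: "set_integrable lborel {0<..} (?M (s + 1))" "set_integrable lborel {0<..} (\<lambda>t. r * ?M s t)"
    using gap_moment(1)[of B s m y A] gap_moment(1)[of B "s + 1" m y A] B assms by auto
  have factor: "?M (s + 1) t - r * ?M s t = t powr (s - 1) * ((t - r) * gap m y A B t)" if "t > 0" for t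
    using that powr_mult_base[of t "s - 1"] by (simp add: algebra_simps)
  have "(LBINT t:{0<..}. ?M (s + 1) t) - (LBINT t:{0<..}. r * ?M s t) < 0"
    unfolding set_integral_diff(2)[OF int, symmetric]
  proof (rule set_integral_neg)
    show "set_integrable lborel {0<..} (\<lambda>t. ?M (s + 1) t - r * ?M s t)"
      by (rule set_integral_diff(1)[OF int])
    show "?M (s + 1) t - r * ?M s t \<le> 0" if "t > 0" for t
      unfolding factor[OF that] using r[OF that] that A B
      by (intro mult_nonneg_nonpos[of "t powr (s - 1)"] mult_gap_nonpos) auto
    show "?M (s + 1) t - r * ?M s t < 0" if t: "t > max (\<bar>ln A\<bar> / y) (max 0 r)" for t
    proof -
      have "t > 0" "t > r" using t by auto
      then show ?thesis
        unfolding factor[OF \<open>t > 0\<close>] using t A B neg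
        by (intro mult_pos_neg gap_neg) auto
    qed
  qed
  \<comment> \<open>As \<open>A\<close> is \<open>B powr m\<close>, the left side is
    \<open>B powr s\<close>, and one order higher it is \<open>B powr (s + 1)\<close>.\<close>
  moreover have "A * B powr (s - m) = ?F"
    using F assms B by (simp add: A_def B_def powr_powr flip: powr_add add_divide_distrib)
  moreover have "A * B powr (s + 1 - m) = ?F powr ((s + 1) / s)"
    using F assms B by (simp add: A_def B_def powr_powr flip: powr_add add_divide_distrib)
  ultimately have "Beta (s + 1) (m - (s + 1)) *
      (beta_laplace_norm m (s + 1) y - ?F powr ((s + 1) / s)) < 0"
    using gap_moment(2)[of B s m y A] gap_moment(2)[of B "s + 1" m y A] B assms
    by simp
  then show ?thesis
    using Beta_pos[of "s + 1" "m - (s + 1)"] assms by (simp add: mult_less_0_iff)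
qed

text \<open>With two possible sign changes the multiplier is the quadratic
  \<open>(t - r1) * (t - r2)\<close>. Only its leading term survives integration, since the moments
  of orders \<open>s\<close> and \<open>s + 1\<close> vanish; hence the moment of order
  \<open>s + 2\<close> is negative.\<close>

lemma beta_laplace_norm_turan:
  assumes "0 < s" "s + 2 < m" "y > 0"
  shows "beta_laplace_norm m (s + 2) y * beta_laplace_norm m s y < (beta_laplace_norm m (s + 1) y)\<^sup>2"
proof -
  let ?F = "beta_laplace_norm m s y" and ?G = "beta_laplace_norm m (s + 1) y"
  \<comment> \<open>Chosen so that the moments of \<open>gap\<close> of orders \<open>s\<close> and \<open>s + 1\<close> are zero.\<close>
  define B where "B = ?G / ?F"
  define A where "A = ?F * B powr (m - s)"
  have F: "0 < ?F" "?F < 1" and G: "0 < ?G"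
    using assms by (auto intro!: beta_laplace_norm_pos beta_laplace_norm_less_1)
  have "?G < ?F powr ((s + 1) / s)"
    using assms by (intro beta_laplace_norm_less_powr) auto
  \<comment> \<open>Here \<open>?F < 1\<close> and the exponent is at least 1, so
    \<open>?G < ?F\<close>; this secures the bound \<open>B \<le> 1\<close> on which concavity
    rests.\<close>
  also have "\<dots> \<le> ?F powr 1"
    using F assms by (intro powr_mono') auto
  finally have B: "0 < B" "B \<le> 1"
    using F G by (auto simp: B_def)
  have A: "A > 0"
    using B F by (auto simp: A_def)
  have conc: "concave_on {0..} (log_ratio m y A B)"
    using B assms by (intro concave_on_log_ratio) auto
  have neg: "log_ratio m y A B t < 0" if "t > \<bar>ln A\<bar> / y" for t
    using that B assms by (intro log_ratio_neg) auto
  obtain r1 r2 where r: "\<And>t. t > 0 \<Longrightarrow> (t - r1) * (t - r2) * log_ratio m y A B t \<le> 0"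
    by (rule concave_on_two_sign_changes[OF conc neg]) blast+
  let ?M = "\<lambda>s t. t powr (s - 1) * gap m y A B t"
  \<comment> \<open>Minus the lower-order terms of \<open>(t - r1) * (t - r2)\<close>; each of the
    two parts integrates to zero.\<close>
  let ?L = "\<lambda>t. (r1 + r2) * ?M (s + 1) t - r1 * r2 * ?M s t"
  have int: "set_integrable lborel {0<..} (?M (s + 2))"
    "set_integrable lborel {0<..} (\<lambda>t. (r1 + r2) * ?M (s + 1) t)"
    "set_integrable lborel {0<..} (\<lambda>t. r1 * r2 * ?M s t)"
    using gap_moment(1)[of B s m y A] gap_moment(1)[of B "s + 1" m y A]
      gap_moment(1)[of B "s + 2" m y A] B assms by auto
  have intL: "set_integrable lborel {0<..} ?L"
    by (rule set_integral_diff(1)[OF int(2,3)])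
  have factor: "?M (s + 2) t - ?L t = t powr (s - 1) * ((t - r1) * (t - r2) * gap m y A B t)"
    if "t > 0" for t
  proof -
    have "t powr (s + 1 - 1) = t * t powr (s - 1)" "t powr (s + 2 - 1) = t * t * t powr (s - 1)"
      using that powr_mult_base[of t "s - 1"] powr_mult_base[of t s] by (simp_all add: algebra_simps)
    then show ?thesis
      by (simp only:) (simp add: algebra_simps)
  qed
  have "(LBINT t:{0<..}. ?M (s + 2) t)
      - ((LBINT t:{0<..}. (r1 + r2) * ?M (s + 1) t) - (LBINT t:{0<..}. r1 * r2 * ?M s t)) < 0"
    unfolding set_integral_diff(2)[OF int(2,3), symmetric] set_integral_diff(2)[OF int(1) intL, symmetric]
  proof (rule set_integral_neg)
    show "set_integrable lborel {0<..} (\<lambda>t. ?M (s + 2) t - ?L t)"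
      by (rule set_integral_diff(1)[OF int(1) intL])
    show "?M (s + 2) t - ?L t \<le> 0" if "t > 0" for t
      unfolding factor[OF that] using r[OF that] that A B
      by (intro mult_nonneg_nonpos[of "t powr (s - 1)"] mult_gap_nonpos) auto
    show "?M (s + 2) t - ?L t < 0" if t: "t > max (\<bar>ln A\<bar> / y) (max 0 (max r1 r2))" for t
    proof -
      have "t > 0" "t > r1" "t > r2" using t by auto
      then show ?thesis
        unfolding factor[OF \<open>t > 0\<close>] using t A B neg
        by (intro mult_pos_neg mult_pos_pos gap_neg) auto
    qed
  qed
  moreover
  \<comment> \<open>The comparison moments form a geometric progression with ratio \<open>B\<close>;
    \<open>k\<close> = 0, 1, 2 give the three values needed.\<close>
  have pow: "A * B powr (s + k - m) = ?F * B powr k" for k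
  proof -
    have "A * B powr (s + k - m) = ?F * (B powr (m - s) * B powr (s + k - m))"
      by (simp add: A_def)
    also have "B powr (m - s) * B powr (s + k - m) = B powr k"
      by (simp flip: powr_add)
    finally show ?thesis .
  qed
  moreover have "A * B powr (s - m) = ?F"
    using pow[of 0] B by simp
  moreover have "A * B powr (s + 1 - m) = ?G"
    using pow[of 1] B F G by (simp add: B_def)
  moreover have "A * B powr (s + 2 - m) = ?G\<^sup>2 / ?F"
    using pow[of 2] B F by (simp add: B_def power2_eq_square)
  ultimately have "Beta (s + 2) (m - (s + 2)) * (beta_laplace_norm m (s + 2) y - ?G\<^sup>2 / ?F) < 0"
    using gap_moment(2)[of B s m y A] gap_moment(2)[of B "s + 1" m y A]
      gap_moment(2)[of B "s + 2" m y A] B assms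
    by simp
  then have "beta_laplace_norm m (s + 2) y < ?G\<^sup>2 / ?F"
    using Beta_pos[of "s + 2" "m - (s + 2)"] assms by (simp add: mult_less_0_iff)
  then show ?thesis
    using F by (simp add: field_simps)
qed


section \<open>Differentiation in the Laplace variable and monotonicity\<close>

lemma Gamma_plus1_pos:
  fixes z :: real
  assumes "z > 0"
  shows "Gamma (z + 1) = z * Gamma z"
  using assms by (intro Gamma_plus1) (auto dest: nonpos_Ints_nonpos)

text \<open>Dominated convergence, with the integrand at parameter 0 as majorant. The endpoint 0 is
  included because the later monotonicity argument starts there.\<close>

lemma beta_laplace_continuous_on:
  assumes "0 < s" "s < m"
  shows "continuous_on {0..} (beta_laplace m s)"
  unfolding continuous_on_sequentially
proof (intro allI impI ballI)
  let ?h = "\<lambda>y t. indicator {0<..} t *\<^sub>R (exp (- (y * t)) * t powr (s - 1) * (1 + t) powr (- m)) :: real"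
  fix Y :: "nat \<Rightarrow> real" and y
  assume "y \<in> {0..}" "(\<forall>n. Y n \<in> {0..}) \<and> Y \<longlonglongrightarrow> y"
  then have Y: "Y n \<ge> 0" "Y \<longlonglongrightarrow> y" for n
    by auto
  have "(\<lambda>n. integral\<^sup>L lborel (?h (Y n))) \<longlonglongrightarrow> integral\<^sup>L lborel (?h y)"
  proof (rule integral_dominated_convergence[where w = "?h 0"])
    show "integrable lborel (?h 0)"
      using beta_laplace_integrable[of s m 0] assms by (simp add: set_integrable_def)
    show "AE t in lborel. (\<lambda>n. ?h (Y n) t) \<longlonglongrightarrow> ?h y t"
      using Y(2) by (intro AE_I2 tendsto_intros)
    show "AE t in lborel. norm (?h (Y n) t) \<le> ?h 0 t" for n
      using Y(1)[of n] by (intro AE_I2) (auto simp: indicator_def abs_mult mult.assoc intro!: mult_left_le_one_le)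
  qed auto
  then show "(beta_laplace m s \<circ> Y) \<longlonglongrightarrow> beta_laplace m s y"
    by (simp add: beta_laplace_def set_lebesgue_integral_def comp_def)
qed

text \<open>Integrates the pointwise bound \<open>1 + u \<le> exp u\<close> at
  \<open>u = - ((z - y) * t)\<close>. This convexity estimate replaces differentiation under the
  integral sign.\<close>

lemma beta_laplace_above_tangent:
  assumes "0 < s" "s + 1 < m" "y \<ge> 0" "z \<ge> 0"
  shows "beta_laplace m s y - (z - y) * beta_laplace m (s + 1) y \<le> beta_laplace m s z"
proof -
  let ?h = "\<lambda>s y t. exp (- (y * t)) * t powr (s - 1) * (1 + t) powr (- m)"
  have int: "set_integrable lborel {0<..} (?h s y)" "set_integrable lborel {0<..} (?h s z)"
    "set_integrable lborel {0<..} (\<lambda>t. (z - y) * ?h (s + 1) y t)"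
    using beta_laplace_integrable[of s m] beta_laplace_integrable[of "s + 1" m y] assms by auto
  have "(LBINT t:{0<..}. ?h s y t - (z - y) * ?h (s + 1) y t) \<le> (LBINT t:{0<..}. ?h s z t)"
  proof (rule set_integral_mono)
    fix t :: real assume t: "t \<in> {0<..}"
    have "1 - (z - y) * t \<le> exp (- ((z - y) * t))"
      using exp_ge_add_one_self[of "- ((z - y) * t)"] by simp
    then have "exp (- (y * t)) * (1 - (z - y) * t) \<le> exp (- (y * t)) * exp (- ((z - y) * t))"
      by (intro mult_left_mono) auto
    also have "\<dots> = exp (- (z * t))"
      by (simp add: algebra_simps flip: exp_add)
    finally have "exp (- (y * t)) * (1 - (z - y) * t) * (t powr (s - 1) * (1 + t) powr (- m))
        \<le> exp (- (z * t)) * (t powr (s - 1) * (1 + t) powr (- m))"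
      by (intro mult_right_mono) auto
    moreover have "t powr (s + 1 - 1) = t * t powr (s - 1)"
      using t powr_mult_base[of t "s - 1"] by simp
    ultimately show "?h s y t - (z - y) * ?h (s + 1) y t \<le> ?h s z t"
      by (simp only:) (simp add: algebra_simps)
  qed (use set_integral_diff(1)[OF int(1,3)] int in auto)
  then show ?thesis
    unfolding set_integral_diff(2)[OF int(1,3)] by (simp add: beta_laplace_def)
qed

text \<open>The tangent bounds at \<open>y\<close> and at \<open>z\<close> squeeze the error of the
  difference quotient below \<open>\<bar>?V z - ?V y\<bar>\<close>, which tends to 0 by
  continuity.\<close>

lemma beta_laplace_has_derivative:
  assumes "0 < s" "s + 1 < m" "y > 0"
  shows "(beta_laplace m s has_real_derivative - beta_laplace m (s + 1) y) (at y)"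
proof -
  let ?J = "beta_laplace m s" and ?V = "beta_laplace m (s + 1)"
  have "isCont ?V y"
    using beta_laplace_continuous_on[of "s + 1" m] assms
    by (intro continuous_on_interior[of "{0..}"]) auto
  then have lim: "((\<lambda>z. \<bar>?V z - ?V y\<bar>) \<longlongrightarrow> 0) (at y)"
    unfolding isCont_def by (simp add: tendsto_rabs_zero LIM_zero)
  have bound: "norm ((?J z - ?J y) / (z - y) - - ?V y) \<le> \<bar>?V z - ?V y\<bar>" if z: "z > 0" "z \<noteq> y" for z
  proof -
    have "?J y - (z - y) * ?V y \<le> ?J z" "?J z - (y - z) * ?V z \<le> ?J y"
      using z assms by (intro beta_laplace_above_tangent; simp)+
    then have "0 \<le> ?J z - ?J y + (z - y) * ?V y" "?J z - ?J y + (z - y) * ?V y \<le> - ((z - y) * (?V z - ?V y))"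
      by (simp_all add: algebra_simps)
    then have "\<bar>?J z - ?J y + (z - y) * ?V y\<bar> \<le> \<bar>z - y\<bar> * \<bar>?V z - ?V y\<bar>"
      unfolding abs_mult[symmetric] by linarith
    moreover have "(?J z - ?J y) / (z - y) - - ?V y = (?J z - ?J y + (z - y) * ?V y) / (z - y)"
      using z by (simp add: field_simps)
    ultimately show ?thesis
      using z by (simp add: divide_le_eq mult.commute)
  qed
  have "((\<lambda>z. (?J z - ?J y) / (z - y) - - ?V y) \<longlongrightarrow> 0) (at y)"
  proof (rule Lim_null_comparison[OF _ lim])
    have "\<forall>\<^sub>F z in at y. z > 0"
      using assms by (intro order_tendstoD[OF tendsto_ident_at]) auto
    moreover have "\<forall>\<^sub>F z in at y. z \<noteq> y"
      by (simp add: eventually_at_filter)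
    ultimately show "\<forall>\<^sub>F z in at y. norm ((?J z - ?J y) / (z - y) - - ?V y) \<le> \<bar>?V z - ?V y\<bar>"
      by eventually_elim (rule bound)
  qed
  then show ?thesis
    unfolding has_field_derivative_iff by (rule LIM_zero_cancel)
qed

text \<open>The factor \<open>s / (m - s - 1)\<close> is the ratio of the two consecutive Beta
  normalisations.\<close>

lemma beta_laplace_norm_has_derivative:
  assumes "0 < s" "s + 1 < m" "y > 0"
  shows "(beta_laplace_norm m s has_real_derivative
    - (s / (m - s - 1) * beta_laplace_norm m (s + 1) y)) (at y)"
proof -
  have Bpos: "Beta s (m - s) > 0" "Beta (s + 1) (m - (s + 1)) > 0"
    using assms by (auto intro!: Beta_pos)
  have "Gamma (s + 1) = s * Gamma s" "Gamma (m - s) = (m - s - 1) * Gamma (m - s - 1)"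
    using assms Gamma_plus1_pos[of s] Gamma_plus1_pos[of "m - s - 1"] by auto
  then have rel: "(m - s - 1) * Beta (s + 1) (m - (s + 1)) = s * Beta s (m - s)"
    by (simp add: Beta_def diff_diff_eq[symmetric])
  have "((\<lambda>y. beta_laplace m s y / Beta s (m - s)) has_real_derivative
      - beta_laplace m (s + 1) y / Beta s (m - s)) (at y)"
    by (intro DERIV_cdivide beta_laplace_has_derivative assms)
  also have "- beta_laplace m (s + 1) y / Beta s (m - s)
      = - (s / (m - s - 1) * beta_laplace_norm m (s + 1) y)"
    using rel Bpos assms by (simp add: beta_laplace_norm_def field_simps)
  finally show ?thesis
    by (simp add: beta_laplace_norm_def[abs_def])
qed

lemma beta_laplace_norm_continuous_on:
  assumes "0 < s" "s < m"
  shows "continuous_on {0..} (beta_laplace_norm m s)"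
  using beta_laplace_continuous_on[OF assms] Beta_pos[of s "m - s"] assms
  by (auto simp: beta_laplace_norm_def[abs_def] intro!: continuous_intros)

lemma beta_laplace_norm_ln_less:
  assumes "0 < s" "s + 2 < m" "x > 0"
  shows "(s + 1) * (m - s - 1) / (s * (m - s - 2)) * ln (beta_laplace_norm m s x)
    < ln (beta_laplace_norm m (s + 1) x)"
proof -
  let ?F = "beta_laplace_norm m s" and ?G = "beta_laplace_norm m (s + 1)"
    and ?K = "beta_laplace_norm m (s + 2)"
  \<comment> \<open>Chosen so that \<open>\<kappa> * (s / (m - s - 1))\<close> is
    \<open>(s + 1) / (m - s - 2)\<close>: both terms of the derivative of \<open>D\<close> then
    share one factor, and the Turan inequality gives its sign.\<close>
  define \<kappa> where "\<kappa> = (s + 1) * (m - s - 1) / (s * (m - s - 2))"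
  define D where "D = (\<lambda>y. ln (?G y) - \<kappa> * ln (?F y))"
  have pos: "?F y > 0" "?G y > 0" if "y \<ge> 0" for y
    using assms that by (auto intro!: beta_laplace_norm_pos)
  have "D 0 < D x"
  \<comment> \<open>The derivative is available only for positive arguments; at 0 continuity
    suffices.\<close>
  proof (rule DERIV_pos_imp_increasing_open[OF \<open>x > 0\<close>])
    have "continuous_on {0..} D"
      unfolding D_def using assms pos
      by (intro continuous_intros beta_laplace_norm_continuous_on)
         (auto simp: less_imp_neq[symmetric])
    then show "continuous_on {0..x} D"
      by (rule continuous_on_subset) auto
  next
    fix y assume y: "0 < y" "y < x"
    have F: "?F y > 0" and G: "?G y > 0"
      using pos y by auto
    have dF: "(?F has_real_derivative - (s / (m - s - 1) * ?G y)) (at y)"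
      using assms y by (intro beta_laplace_norm_has_derivative) auto
    have dG: "(?G has_real_derivative - ((s + 1) / (m - s - 2) * ?K y)) (at y)"
      using beta_laplace_norm_has_derivative[of "s + 1" m y] assms y
      by (simp add: add.assoc diff_diff_eq)
    let ?d = "(s + 1) / (m - s - 2) * (?G y / ?F y - ?K y / ?G y)"
    have "(D has_real_derivative - ((s + 1) / (m - s - 2) * ?K y) / ?G y
        - \<kappa> * (- (s / (m - s - 1) * ?G y) / ?F y)) (at y)"
      unfolding D_def
      by (rule DERIV_cong, (rule derivative_intros dF dG F G)+) (simp add: mult_ac)
    also have "\<kappa> * (- (s / (m - s - 1) * ?G y) / ?F y)
        = - ((s + 1) / (m - s - 2) * (?G y / ?F y))"
      using assms by (simp add: \<kappa>_def)
    finally have "(D has_real_derivative ?d) (at y)"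
      by (simp add: algebra_simps)
    moreover have "?K y / ?G y < ?G y / ?F y"
      using beta_laplace_norm_turan[of s m y] F G assms y
      by (simp add: divide_less_eq less_divide_eq power2_eq_square)
    then have "?d > 0"
      using assms by (intro mult_pos_pos) auto
    ultimately show "\<exists>d. (D has_real_derivative d) (at y) \<and> d > 0"
      by blast
  qed
  moreover have "D 0 = 0"
    using assms by (simp add: D_def beta_laplace_norm_0)
  ultimately show ?thesis
    by (simp add: D_def \<kappa>_def)
qed

section \<open>Translation to the Tricomi function and the four inequalities\<close>

lemma tricomi_eq_beta_laplace:
  "tricomi a c x = beta_laplace (a - c + 1) a x / Gamma a"
  by (simp add: tricomi_def beta_laplace_def algebra_simps)

lemma tricomi_eq_beta_laplace_norm:
  assumes "a > 0" "c < 1"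
  shows "tricomi a c x = Gamma (1 - c) / Gamma (a - c + 1) * beta_laplace_norm (a - c + 1) a x"
proof -
  have "Gamma a > 0" "Gamma (1 - c) > 0" "Gamma (a - c + 1) > 0"
    using assms by auto
  moreover have "a - c + 1 - a = 1 - c" "a + (1 - c) = a - c + 1"
    by auto
  ultimately show ?thesis
    by (simp add: tricomi_eq_beta_laplace beta_laplace_norm_def Beta_def field_simps)
qed

theorem theorem4:
  fixes a c x :: real
  shows
    "(a > 0 \<and> 0 > c \<and> x > 0 \<longrightarrow>
        (Gamma (a - c + 1) / Gamma (- c) * tricomi (a + 1) (c + 1) x) powr (1 / (a + 1))
          < (Gamma (a - c + 1) / Gamma (1 - c) * tricomi a c x) powr (1 / a)
      \<and> 2 < tricomi a c x / tricomi (a + 1) (c + 1) x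
            - 1 / c * (Gamma (a - c + 1) / Gamma (1 - c) * tricomi a c x) powr (1 / a))
   \<and> (a > 0 \<and> c < -1 \<and> x > 0 \<longrightarrow>
        (Gamma (a - c + 1) / Gamma (1 - c) * tricomi a c x) powr (c / (a * (c + 1)))
          < (Gamma (a - c + 1) / Gamma (- c) * tricomi (a + 1) (c + 1) x) powr (1 / (a + 1)))
   \<and> (a > 0 \<and> 0 > c \<and> x > 0 \<longrightarrow>
        tricomi (a + 1) (c + 1) x < - (1 / c) * tricomi a c x)"
proof -
  define m where "m = a - c + 1"
  define F where "F = beta_laplace_norm m a x"
  define G where "G = beta_laplace_norm m (a + 1) x"
  have main: "G < F powr ((a + 1) / a) \<and> 0 < F \<and> F < 1 \<and> 0 < G \<and>
      Gamma (a - c + 1) / Gamma (1 - c) * tricomi a c x = F \<and>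
      Gamma (a - c + 1) / Gamma (- c) * tricomi (a + 1) (c + 1) x = G \<and>
      tricomi (a + 1) (c + 1) x > 0 \<and>
      tricomi a c x / tricomi (a + 1) (c + 1) x = - c * F / G"
    if "a > 0" "c < 0" "x > 0"
  proof -
    have F: "0 < F" "F < 1" and G: "0 < G" and less: "G < F powr ((a + 1) / a)"
      using that unfolding F_def G_def m_def
      by (auto intro!: beta_laplace_norm_pos beta_laplace_norm_less_1 beta_laplace_norm_less_powr)
    \<comment> \<open>The last identity is the source of the factor \<open>- c\<close> in the
      quotient of the two Tricomi values.\<close>
    have Gam: "Gamma (- c) > 0" "Gamma (a - c + 1) > 0" "Gamma (1 - c) = - c * Gamma (- c)"
      using that Gamma_plus1_pos[of "- c"] by auto
    have "tricomi a c x = Gamma (1 - c) / Gamma (a - c + 1) * F"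
      using tricomi_eq_beta_laplace_norm[of a c x] that by (simp add: F_def m_def)
    moreover have "tricomi (a + 1) (c + 1) x = Gamma (- c) / Gamma (a - c + 1) * G"
      using tricomi_eq_beta_laplace_norm[of "a + 1" "c + 1" x] that by (simp add: G_def m_def)
    ultimately show ?thesis
      using F G Gam less that by simp (metis Gam(1,2) less_irrefl)
  qed
  have i: "G powr (1 / (a + 1)) < F powr (1 / a)" if "a > 0" "c < 0" "x > 0"
  proof -
    have "G powr (1 / (a + 1)) < (F powr ((a + 1) / a)) powr (1 / (a + 1))"
      using main[OF that] that by (intro powr_less_mono2) auto
    then show ?thesis
      using that by (simp add: powr_powr)
  qed
  have i': "2 < - c * F / G - 1 / c * F powr (1 / a)" if "a > 0" "c < 0" "x > 0"
  proof -
    let ?u = "F powr (1 / a)"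
    have u: "?u > 0" and G: "G > 0" and F: "F > 0"
      using main[OF that] by auto
    have "(a + 1) / a = 1 + 1 / a"
      using that by (simp add: field_simps)
    then have "G < F * ?u"
      using main[OF that] F by (simp add: powr_add)
    then have "1 / ?u < F / G"
      using u G by (simp add: field_simps)
    then have "- c * (1 / ?u) < - c * (F / G)"
      using that by (intro mult_strict_left_mono) auto
    \<comment> \<open>AM-GM for \<open>- c / ?u\<close> and its reciprocal, with the defect written
      as a square over a positive number.\<close>
    moreover have "2 \<le> - c * (1 / ?u) - 1 / c * ?u"
    proof -
      have "- c * (1 / ?u) - 1 / c * ?u - 2 = (c + ?u)\<^sup>2 / (- c * ?u)"
        using u that by (simp add: field_simps power2_eq_square)
      also have "\<dots> \<ge> 0"
        using u that by (intro divide_nonneg_pos) (auto simp: mult_neg_pos)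
      finally show ?thesis by simp
    qed
    ultimately show ?thesis
      by simp
  qed
  have ii: "F powr (c / (a * (c + 1))) < G powr (1 / (a + 1))" if "a > 0" "c < -1" "x > 0"
  proof -
    have F: "F > 0" and G: "G > 0"
      using main that by auto
    have m: "a + 2 < m" "m - a - 1 = - c" "m - a - 2 = - c - 1"
      using that by (simp_all add: m_def)
    have "(a + 1) * (- c) / (a * (- c - 1)) * ln F < ln G"
      using beta_laplace_norm_ln_less[OF that(1) m(1) that(3)] unfolding m(2,3) F_def G_def .
    \<comment> \<open>The minus signs cancel, leaving \<open>a + 1\<close> times the exponent in
      (ii).\<close>
    moreover have "(a + 1) * (- c) / (a * (- c - 1)) = (a + 1) * (c / (a * (c + 1)))"
      using that by (simp add: divide_simps) (simp add: algebra_simps)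
    ultimately have "(a + 1) * (c / (a * (c + 1))) * ln F < ln G"
      by (simp only:)
    also have "ln G = (a + 1) * (1 / (a + 1) * ln G)"
      using that by simp
    finally have "(a + 1) * (c / (a * (c + 1)) * ln F) < (a + 1) * (1 / (a + 1) * ln G)"
      by (simp only: mult.assoc)
    then have "c / (a * (c + 1)) * ln F < 1 / (a + 1) * ln G"
      using that by (subst (asm) mult_less_cancel_left_pos) auto
    then show ?thesis
      using F G by (simp add: powr_def)
  qed
  have iii: "tricomi (a + 1) (c + 1) x < - (1 / c) * tricomi a c x" if "a > 0" "c < 0" "x > 0"
  proof -
    have "G < F powr ((a + 1) / a)"
      using main[OF that] by simp
    \<comment> \<open>As \<open>F < 1\<close>, raising the exponent above 1 only lowers the
      power.\<close>
    also have "\<dots> \<le> F powr 1"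
      using main[OF that] that by (intro powr_mono') auto
    finally have "1 < F / G"
      using main[OF that] by simp
    also have "F / G = - (1 / c) * (- c * F / G)"
      using that by simp
    also have "- c * F / G = tricomi a c x / tricomi (a + 1) (c + 1) x"
      using main[OF that] by simp
    finally have less: "1 < - (1 / c) * tricomi a c x / tricomi (a + 1) (c + 1) x"
      by simp
    have "tricomi (a + 1) (c + 1) x > 0"
      using main[OF that] by simp
    then show ?thesis
      using less by (simp only: less_divide_eq_1_pos)
  qed
  show ?thesis
  proof (intro conjI impI; elim conjE)
    assume h: "a > 0" "0 > c" "x > 0"
    show "(Gamma (a - c + 1) / Gamma (- c) * tricomi (a + 1) (c + 1) x) powr (1 / (a + 1))
        < (Gamma (a - c + 1) / Gamma (1 - c) * tricomi a c x) powr (1 / a)"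
      using i[OF h] main[OF h] by simp
    show "2 < tricomi a c x / tricomi (a + 1) (c + 1) x
        - 1 / c * (Gamma (a - c + 1) / Gamma (1 - c) * tricomi a c x) powr (1 / a)"
      using i'[OF h] main[OF h] by simp
    show "tricomi (a + 1) (c + 1) x < - (1 / c) * tricomi a c x"
      by (rule iii[OF h])
  next
    assume h: "a > 0" "c < -1" "x > 0"
    then have "c < 0" by simp
    show "(Gamma (a - c + 1) / Gamma (1 - c) * tricomi a c x) powr (c / (a * (c + 1)))
        < (Gamma (a - c + 1) / Gamma (- c) * tricomi (a + 1) (c + 1) x) powr (1 / (a + 1))"
      using ii[OF h] main[OF h(1) \<open>c < 0\<close> h(3)] by simp
  qed
qed

end
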